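(* Let $A \in \mathbb{R}^{n \times n}$ and $D \in \mathbb{R}^{p \times p}$ be symmetric positive definite matrices, let $B \in \mathbb{R}^{m \times n}$ be of full row rank, let $C \in \mathbb{R}^{p \times n}$ be rank-deficient, and let $\alpha > 0$ and $\beta > 0$. Let $\tilde{\mathcal{A}}$ and $\mathcal{Q}$ be the block matrices defined in the context. Then the preconditioned matrix $\mathcal{Q}^{-1}\tilde{\mathcal{A}}$ has an eigenvalue equal to $1$ with algebraic multiplicity at least $p$. Moreover, the remaining eigenvalues of $\mathcal{Q}^{-1}\tilde{\mathcal{A}}$ coincide with the eigenvalues of the $(n+m)\times(n+m)$ matrix $$\Gamma = \begin{pmatrix} I + \bigl( C^{T} D^{-1} C - \alpha B^{T} B \bigr) M^{-1} & \dfrac{1}{\beta} \bigl( C^{T} D^{-1} C - \alpha B^{T} B \bigr) M^{-1} B^{T} \\[8pt] B M^{-1} & \dfrac{1}{\beta} B M^{-1} B^{T} \end{pmatrix},$$ where $M = A + \bigl( \alpha + \tfrac{1}{\beta} \bigr) B^{T} B$.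
   Context: Given $A, B, C, D$ and $\alpha, \beta > 0$ as in the claim, define the following $3\times 3$ block matrices of order $n+m+p$ (with block sizes $n, m, p$): $$\tilde{\mathcal{A}} = \begin{pmatrix} A & B^{T} & C^{T} \\ B & 0 & 0 \\ C & 0 & -D \end{pmatrix}, \qquad \mathcal{Q} = \begin{pmatrix} A + \alpha B^{T}B & B^T & 0 \\ B & -\beta I & 0 \\ C & 0 & -D \end{pmatrix}.$$ The matrix $\mathcal{Q}$ is nonsingular. "Rank-deficient" means that the rank is less than $\min\{p,n\}$. "The remaining eigenvalues" are the $n+m$ eigenvalues, counted with algebraic multiplicity, left after removing $p$ copies of the eigenvalue $1$. *)

theory Defs
  imports
    "Jordan_Normal_Form.Char_Poly"
    "Jordan_Normal_Form.Gauss_Jordan_Elimination"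
    "Jordan_Normal_Form.DL_Rank"
    "HOL-Computational_Algebra.Fundamental_Theorem_Algebra"
begin

definition spd_mat :: "nat \<Rightarrow> real mat \<Rightarrow> bool" where
  "spd_mat n A \<longleftrightarrow> A \<in> carrier_mat n n \<and> transpose_mat A = A \<and>
     (\<forall>v \<in> carrier_vec n. v \<noteq> 0\<^sub>v n \<longrightarrow> 0 < v \<bullet> (A *\<^sub>v v))"

text \<open>Column rank of a matrix with \<open>r\<close> rows.\<close>

abbreviation rank_mat :: "nat \<Rightarrow> real mat \<Rightarrow> nat" where
  "rank_mat r A \<equiv> vec_space.rank r A"

text \<open>The inverse of a nonsingular matrix; the value is unspecified if the matrix is singular.\<close>

definition inv_mat :: "real mat \<Rightarrow> real mat" where
  "inv_mat A = the (mat_inverse A)"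

definition append_cols_mat :: "'a :: zero mat \<Rightarrow> 'a mat \<Rightarrow> 'a mat" where
  "append_cols_mat A B = four_block_mat A B (0\<^sub>m 0 (dim_col A)) (0\<^sub>m 0 (dim_col B))"

definition nine_block_mat ::
  "'a :: zero mat \<Rightarrow> 'a mat \<Rightarrow> 'a mat \<Rightarrow>
   'a mat \<Rightarrow> 'a mat \<Rightarrow> 'a mat \<Rightarrow>
   'a mat \<Rightarrow> 'a mat \<Rightarrow> 'a mat \<Rightarrow> 'a mat" where
  "nine_block_mat A11 A12 A13 A21 A22 A23 A31 A32 A33 =
     four_block_mat (four_block_mat A11 A12 A21 A22) (append_rows A13 A23)
                    (append_cols_mat A31 A32) A33"

definition tildeA_mat ::
  "nat \<Rightarrow> nat \<Rightarrow> nat \<Rightarrow> real mat \<Rightarrow> real mat \<Rightarrow> real mat \<Rightarrow> real mat \<Rightarrow> real mat" where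
  "tildeA_mat n m p A B C D = nine_block_mat
     A  (transpose_mat B)  (transpose_mat C)
     B  (0\<^sub>m m m)          (0\<^sub>m m p)
     C  (0\<^sub>m p m)          (- D)"

definition Q_mat ::
  "nat \<Rightarrow> nat \<Rightarrow> nat \<Rightarrow> real \<Rightarrow> real \<Rightarrow> real mat \<Rightarrow> real mat \<Rightarrow> real mat \<Rightarrow> real mat \<Rightarrow> real mat" where
  "Q_mat n m p \<alpha> \<beta> A B C D = nine_block_mat
     (A + \<alpha> \<cdot>\<^sub>m (transpose_mat B * B))  (transpose_mat B)    (0\<^sub>m n p)
     B                              (- (\<beta> \<cdot>\<^sub>m 1\<^sub>m m))        (0\<^sub>m m p)
     C                              (0\<^sub>m p m)            (- D)"

definition M_mat :: "real \<Rightarrow> real \<Rightarrow> real mat \<Rightarrow> real mat \<Rightarrow> real mat" where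
  "M_mat \<alpha> \<beta> A B = A + (\<alpha> + 1 / \<beta>) \<cdot>\<^sub>m (transpose_mat B * B)"

definition Gamma_mat ::
  "nat \<Rightarrow> real \<Rightarrow> real \<Rightarrow> real mat \<Rightarrow> real mat \<Rightarrow> real mat \<Rightarrow> real mat \<Rightarrow> real mat" where
  "Gamma_mat n \<alpha> \<beta> A B C D =
     (let Mi = inv_mat (M_mat \<alpha> \<beta> A B);
          K = transpose_mat C * inv_mat D * C - \<alpha> \<cdot>\<^sub>m (transpose_mat B * B)
      in four_block_mat
           (1\<^sub>m n + K * Mi)  ((1 / \<beta>) \<cdot>\<^sub>m (K * Mi * transpose_mat B))
           (B * Mi)         ((1 / \<beta>) \<cdot>\<^sub>m (B * Mi * transpose_mat B)))"

text \<open>The complex eigenvalues of a real square matrix, each repeated according to its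
  algebraic multiplicity.\<close>

definition complex_eigvals :: "real mat \<Rightarrow> complex multiset" where
  "complex_eigvals A = proots (char_poly (map_mat complex_of_real A))"

end

theory Submission
  imports Defs
begin

text \<open>
  Group the first two block rows and columns, of total size \<open>N = n + m\<close>, and write
  \<open>Q = (Q1, 0; H, -D)\<close> and \<open>T = (S, G; H, -D)\<close> for the preconditioner and the saddle point
  matrix, where \<open>H = (C, 0)\<close> and \<open>G\<close> is the transpose of \<open>H\<close>. Both have the same last block row,
  so \<open>T\<close> arises from \<open>Q\<close> by multiplying from the left with a block upper triangular matrix
  \<open>U = (L, - G D\<^sup>-\<^sup>1; 0, I)\<close>, where \<open>L\<close> is determined by \<open>L Q1 = S + G D\<^sup>-\<^sup>1 H\<close>. Hence
  \<open>Q\<^sup>-\<^sup>1 T = Q\<^sup>-\<^sup>1 U Q\<close> is similar to \<open>U\<close>, whose characteristic polynomial is that of \<open>L\<close> times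
  \<open>(x - 1)\<^sup>p\<close>; this is \<open>block_preconditioned_char_poly\<close>.

  It remains to see that \<open>L\<close> is \<open>\<Gamma>\<close> itself and that \<open>Q1\<close> is nonsingular. With
  \<open>X = A + \<alpha> B\<^sup>T B\<close> and \<open>K = C\<^sup>T D\<^sup>-\<^sup>1 C - \<alpha> B\<^sup>T B\<close> we have \<open>Q1 = (X, B\<^sup>T; B, -\<beta> I)\<close> and
  \<open>S + G D\<^sup>-\<^sup>1 H = (X + K, B\<^sup>T; B, 0)\<close>. The matrix \<open>M = X + (1 / \<beta>) B\<^sup>T B\<close> is the Schur complement
  of \<open>-\<beta> I\<close> in \<open>Q1\<close>. It is positive definite (\<open>spd_mat_add_gram\<close>), so \<open>Q1\<close> is nonsingular
  (\<open>saddle_block_det\<close>), and multiplying out blocks gives \<open>\<Gamma> Q1 = S + G D\<^sup>-\<^sup>1 H\<close>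
  (\<open>Gamma_mat_mult_leading_block\<close>).

  Finally, the rank of \<open>C\<close> is less than \<open>p\<close>, so \<open>p > 0\<close> and \<open>1\<close> is an actual eigenvalue.
\<close>

section \<open>Inverses and similarity\<close>

lemma inv_mat_inverse:
  assumes X: "X \<in> carrier_mat n n" and det: "det X \<noteq> 0"
  shows "inv_mat X \<in> carrier_mat n n" "X * inv_mat X = 1\<^sub>m n" "inv_mat X * X = 1\<^sub>m n"
proof -
  have "X \<in> Units (ring_mat TYPE(real) n ())"
    by (rule det_non_zero_imp_unit[OF X det])
  then obtain Y where "mat_inverse X = Some Y"
    using mat_inverse(1)[OF X, of "()"] by (cases "mat_inverse X") auto
  then show "inv_mat X \<in> carrier_mat n n" "X * inv_mat X = 1\<^sub>m n" "inv_mat X * X = 1\<^sub>m n"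
    using mat_inverse(2)[OF X] by (auto simp: inv_mat_def)
qed

lemma invertible_mat_if_det:
  assumes "(X :: real mat) \<in> carrier_mat n n" "det X \<noteq> 0"
  shows "invertible_mat X"
  using inv_mat_inverse[OF assms] assms(1)
  unfolding invertible_mat_def inverts_mat_def square_mat.simps
  by (metis carrier_matD)

text \<open>Similarity in the form \<open>X R = G X\<close>, which can be checked without computing an inverse.\<close>

lemma char_poly_intertwine:
  fixes X R G :: "real mat"
  assumes X: "X \<in> carrier_mat n n" and R: "R \<in> carrier_mat n n" and G: "G \<in> carrier_mat n n"
    and det: "det X \<noteq> 0" and eq: "X * R = G * X"
  shows "char_poly R = char_poly G"
proof -
  note Xi = inv_mat_inverse[OF X det]
  have "R = (inv_mat X * X) * R" using Xi R by simp
  also have "\<dots> = inv_mat X * (G * X)" using assoc_mult_mat[OF Xi(1) X R] eq by simp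
  also have "\<dots> = inv_mat X * G * X" using assoc_mult_mat[OF Xi(1) G X] by simp
  finally have "similar_mat R G"
    by (intro similar_matI[where P = "inv_mat X" and Q = X and n = n]) (use X R G Xi in auto)
  then show ?thesis by (rule char_poly_similar)
qed

lemma char_poly_four_block_lower_left_zero:
  fixes A1 :: "'a :: idom mat"
  assumes A1: "A1 \<in> carrier_mat n n" and A2: "A2 \<in> carrier_mat n m" and A4: "A4 \<in> carrier_mat m m"
  shows "char_poly (four_block_mat A1 A2 (0\<^sub>m m n) A4) = char_poly A1 * char_poly A4"
proof -
  have "char_poly_matrix (four_block_mat A1 A2 (0\<^sub>m m n) A4) =
      four_block_mat (char_poly_matrix A1) (map_mat (\<lambda>a. [:- a:]) A2) (0\<^sub>m m n) (char_poly_matrix A4)"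
    unfolding char_poly_matrix_def by (rule eq_matI) (use A1 A2 A4 in \<open>auto simp: one_poly_def\<close>)
  then show ?thesis
    unfolding char_poly_def
    by (simp only:) (rule det_four_block_mat_lower_left_zero, use A1 A2 A4 in auto)
qed

lemma char_poly_one_mat: "char_poly (1\<^sub>m n :: 'a :: comm_ring_1 mat) = [:- 1, 1:] ^ n"
proof -
  have "char_poly (1\<^sub>m n :: 'a mat) = (\<Prod>a\<leftarrow>diag_mat (1\<^sub>m n). [:- a, 1:])"
    by (rule char_poly_upper_triangular[of _ n]) auto
  also have "diag_mat (1\<^sub>m n :: 'a mat) = replicate n 1"
    by (auto simp: diag_mat_def intro: nth_equalityI)
  finally show ?thesis by simp
qed

lemma add_uminus_mat:
  fixes Y :: "'a :: ab_group_add mat"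
  assumes "Y \<in> carrier_mat r c"
  shows "Y + - Y = 0\<^sub>m r c"
  by (rule eq_matI) (use assms in auto)

section \<open>Positive definite matrices\<close>

lemma spd_mat_det:
  assumes "spd_mat n A"
  shows "det A \<noteq> 0"
proof
  assume "det A = 0"
  then obtain v where "v \<in> carrier_vec n" "v \<noteq> 0\<^sub>v n" "A *\<^sub>v v = 0\<^sub>v n"
    using det_0_iff_vec_prod_zero[of A n] assms by (auto simp: spd_mat_def)
  then show False using assms by (force simp: spd_mat_def)
qed

text \<open>The quadratic form of the added term is \<open>c\<close> times the squared length of \<open>B v\<close>. This makes
  \<open>M\<close>, hence the leading block of the preconditioner, nonsingular.\<close>

lemma spd_mat_add_gram:
  assumes A: "spd_mat n A" and B: "B \<in> carrier_mat m n" and c: "0 \<le> c"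
  shows "spd_mat n (A + c \<cdot>\<^sub>m (transpose_mat B * B))"
proof -
  have Ac: "A \<in> carrier_mat n n" and At: "transpose_mat A = A" using A by (auto simp: spd_mat_def)
  have "0 < v \<bullet> ((A + c \<cdot>\<^sub>m (transpose_mat B * B)) *\<^sub>v v)"
    if v: "v \<in> carrier_vec n" and v0: "v \<noteq> 0\<^sub>v n" for v
  proof -
    have Bv: "B *\<^sub>v v \<in> carrier_vec m" using B v by auto
    have smult: "(c \<cdot>\<^sub>m Y) *\<^sub>v v = c \<cdot>\<^sub>v (Y *\<^sub>v v)" if "Y \<in> carrier_mat n n" for Y
      using that v by (intro eq_vecI) (auto simp: smult_scalar_prod_distrib[of _ n])
    have "(A + c \<cdot>\<^sub>m (transpose_mat B * B)) *\<^sub>v v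
        = A *\<^sub>v v + c \<cdot>\<^sub>v (transpose_mat B *\<^sub>v (B *\<^sub>v v))"
      using Ac B v by (simp add: add_mult_distrib_mat_vec[of _ n n] smult
          assoc_mult_mat_vec[of _ n m])
    moreover have "v \<bullet> (transpose_mat B *\<^sub>v (B *\<^sub>v v)) = (B *\<^sub>v v) \<bullet> (B *\<^sub>v v)"
      using transpose_vec_mult_scalar[OF B v Bv] comm_scalar_prod[of v n] Bv B v
      by (metis mult_mat_vec_carrier transpose_carrier_mat)
    ultimately have "v \<bullet> ((A + c \<cdot>\<^sub>m (transpose_mat B * B)) *\<^sub>v v)
        = v \<bullet> (A *\<^sub>v v) + c * ((B *\<^sub>v v) \<bullet> (B *\<^sub>v v))"
      using Ac B v Bv by (simp add: scalar_prod_add_distrib[of _ n])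
    moreover have "0 \<le> (B *\<^sub>v v) \<bullet> (B *\<^sub>v v)"
      by (auto simp: scalar_prod_def intro: sum_nonneg)
    moreover have "0 < v \<bullet> (A *\<^sub>v v)" using A v v0 by (auto simp: spd_mat_def)
    ultimately show ?thesis using c by (simp add: add_pos_nonneg)
  qed
  moreover have "transpose_mat (A + c \<cdot>\<^sub>m (transpose_mat B * B)) = A + c \<cdot>\<^sub>m (transpose_mat B * B)"
  proof -
    have gram: "transpose_mat (transpose_mat B * B) = transpose_mat B * B"
      using B by (simp add: transpose_mult[of _ n m _ n])
    have "transpose_mat (c \<cdot>\<^sub>m Y) = c \<cdot>\<^sub>m transpose_mat Y" for Y :: "real mat"
      by (rule eq_matI) auto
    moreover have "transpose_mat (A + c \<cdot>\<^sub>m (transpose_mat B * B))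
        = transpose_mat A + transpose_mat (c \<cdot>\<^sub>m (transpose_mat B * B))"
      by (rule transpose_add[of _ n n]) (use Ac B in auto)
    ultimately show ?thesis by (simp only: At gram)
  qed
  ultimately show ?thesis using Ac B by (auto simp: spd_mat_def)
qed

section \<open>Block triangular preconditioning\<close>

text \<open>Since \<open>Q\<close> and \<open>T\<close> share their last block row, \<open>T = U Q\<close> for a block upper triangular \<open>U\<close>
  with diagonal blocks \<open>L\<close> and \<open>I\<close>, and \<open>Q\<close> conjugates \<open>Q\<^sup>-\<^sup>1 T\<close> into \<open>U\<close>. Stating the
  condition on \<open>L\<close> as \<open>L Q1 = \<dots>\<close> avoids the inverse of \<open>Q1\<close>.\<close>

lemma block_preconditioned_char_poly:
  fixes Q1 S G H D L P :: "real mat"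
  assumes Q1: "Q1 \<in> carrier_mat N N" and S: "S \<in> carrier_mat N N"
    and G: "G \<in> carrier_mat N p" and H: "H \<in> carrier_mat p N"
    and D: "D \<in> carrier_mat p p" and L: "L \<in> carrier_mat N N"
    and detQ1: "det Q1 \<noteq> 0" and detD: "det D \<noteq> 0"
    and L_eq: "L * Q1 = S + G * inv_mat D * H"
  defines "Q \<equiv> four_block_mat Q1 (0\<^sub>m N p) H (- D)"
    and "T \<equiv> four_block_mat S G H (- D)"
  shows "det Q \<noteq> 0" and "char_poly (inv_mat Q * T) = char_poly L * [:- 1, 1:] ^ p"
proof -
  note Di = inv_mat_inverse[OF D detD]
  have Qc: "Q \<in> carrier_mat (N + p) (N + p)" and Tc: "T \<in> carrier_mat (N + p) (N + p)"
    using Q1 S D by (auto simp: Q_def T_def)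
  have "det Q = det Q1 * det (- D)"
    unfolding Q_def by (rule det_four_block_mat_upper_right_zero) (use Q1 H D in auto)
  then show detQ: "det Q \<noteq> 0" using detQ1 detD det_0_negate[OF D] by simp
  note Qi = inv_mat_inverse[OF Qc detQ]
  define U where "U = four_block_mat L (- (G * inv_mat D)) (0\<^sub>m p N) (1\<^sub>m p)"
  have Uc: "U \<in> carrier_mat (N + p) (N + p)" using L by (auto simp: U_def)
  have W: "G * inv_mat D \<in> carrier_mat N p" using G Di by auto
  have "U * Q = four_block_mat (L * Q1 + - (G * inv_mat D) * H) (L * 0\<^sub>m N p + - (G * inv_mat D) * - D)
      (0\<^sub>m p N * Q1 + 1\<^sub>m p * H) (0\<^sub>m p N * 0\<^sub>m N p + 1\<^sub>m p * - D)"
    unfolding U_def Q_def by (rule mult_four_block_mat[of _ N N _ p _ p _ _ N _ p]) (use L W Q1 H D in auto)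
  also have "L * Q1 + - (G * inv_mat D) * H = S"
  proof -
    have GDH: "G * inv_mat D * H \<in> carrier_mat N N" using W H by auto
    have "- (G * inv_mat D) * H = - (G * inv_mat D * H)"
      by (rule uminus_mult_left_mat) (use W H in auto)
    then show ?thesis
      unfolding L_eq using S GDH by (simp only: assoc_add_mat[OF S GDH] add_uminus_mat[OF GDH] uminus_carrier_mat) simp
  qed
  also have "- (G * inv_mat D) * - D = G"
  proof -
    have "- (G * inv_mat D) * - D = - (G * inv_mat D * - D)"
      by (rule uminus_mult_left_mat) (use W D in auto)
    also have "G * inv_mat D * - D = - (G * inv_mat D * D)"
      by (rule uminus_mult_right_mat) (use W D in auto)
    finally have "- (G * inv_mat D) * - D = G * inv_mat D * D"
      by (simp only: uminus_uminus_mat)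
    then show ?thesis using G Di D by simp
  qed
  finally have UQ: "U * Q = T" using L G H D Q1 by (simp add: T_def)
  have "Q * (inv_mat Q * T) = U * Q"
    using assoc_mult_mat[OF Qc Qi(1) Tc] Qi Tc UQ by simp
  then have "char_poly (inv_mat Q * T) = char_poly U"
    by (intro char_poly_intertwine[OF Qc _ Uc detQ]) (use Qi Tc in auto)
  also have "\<dots> = char_poly L * char_poly (1\<^sub>m p)"
    unfolding U_def by (rule char_poly_four_block_lower_left_zero) (use L W in auto)
  finally show "char_poly (inv_mat Q * T) = char_poly L * [:- 1, 1:] ^ p"
    by (simp add: char_poly_one_mat)
qed

text \<open>Clearing the lower left block \<open>B\<close> by a unipotent column operation leaves the Schur complement
  and \<open>-\<beta> I\<close> on the diagonal.\<close>

lemma saddle_block_det: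
  fixes X B :: "real mat"
  assumes X: "X \<in> carrier_mat n n" and B: "B \<in> carrier_mat m n" and \<beta>: "\<beta> \<noteq> 0"
    and det: "det (X + (1 / \<beta>) \<cdot>\<^sub>m (transpose_mat B * B)) \<noteq> 0"
  shows "det (four_block_mat X (transpose_mat B) B (- (\<beta> \<cdot>\<^sub>m 1\<^sub>m m))) \<noteq> 0" (is "det ?Q1 \<noteq> 0")
proof -
  let ?V = "four_block_mat (1\<^sub>m n) (0\<^sub>m n m) ((1 / \<beta>) \<cdot>\<^sub>m B) (1\<^sub>m m)"
  have mI: "- (\<beta> \<cdot>\<^sub>m 1\<^sub>m m) = (- \<beta>) \<cdot>\<^sub>m (1\<^sub>m m :: real mat)" by auto
  have "?Q1 * ?V = four_block_mat (X * 1\<^sub>m n + transpose_mat B * ((1 / \<beta>) \<cdot>\<^sub>m B))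
      (X * 0\<^sub>m n m + transpose_mat B * 1\<^sub>m m)
      (B * 1\<^sub>m n + - (\<beta> \<cdot>\<^sub>m 1\<^sub>m m) * ((1 / \<beta>) \<cdot>\<^sub>m B)) (B * 0\<^sub>m n m + - (\<beta> \<cdot>\<^sub>m 1\<^sub>m m) * 1\<^sub>m m)"
    by (rule mult_four_block_mat[of _ n n _ m _ m _ _ n _ m]) (use X B in auto)
  also have "B * 1\<^sub>m n + - (\<beta> \<cdot>\<^sub>m 1\<^sub>m m) * ((1 / \<beta>) \<cdot>\<^sub>m B) = 0\<^sub>m m n"
  proof -
    have "- (\<beta> \<cdot>\<^sub>m 1\<^sub>m m) * ((1 / \<beta>) \<cdot>\<^sub>m B) = (- \<beta>) \<cdot>\<^sub>m ((1 / \<beta>) \<cdot>\<^sub>m B)"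
      unfolding mI using B by (simp add: mult_smult_assoc_mat[of _ m m _ n])
    then show ?thesis using B \<beta> by (auto intro!: eq_matI)
  qed
  also have "X * 1\<^sub>m n + transpose_mat B * ((1 / \<beta>) \<cdot>\<^sub>m B) = X + (1 / \<beta>) \<cdot>\<^sub>m (transpose_mat B * B)"
    using X B by (simp add: mult_smult_distrib[of _ n m _ n])
  finally have "?Q1 * ?V = four_block_mat (X + (1 / \<beta>) \<cdot>\<^sub>m (transpose_mat B * B))
      (transpose_mat B) (0\<^sub>m m n) ((- \<beta>) \<cdot>\<^sub>m 1\<^sub>m m)"
    using X B by (simp add: mI)
  then have "det (?Q1 * ?V) = det (X + (1 / \<beta>) \<cdot>\<^sub>m (transpose_mat B * B)) * det ((- \<beta>) \<cdot>\<^sub>m (1\<^sub>m m :: real mat))"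
    by (simp only:) (rule det_four_block_mat_lower_left_zero, use X B in auto)
  then have "det (?Q1 * ?V) \<noteq> 0" using det \<beta> by (simp add: det_smult)
  moreover have "det (?Q1 * ?V) = det ?Q1 * det ?V"
    by (rule det_mult[of _ "n + m"]) (use X B in auto)
  ultimately show ?thesis by auto
qed

text \<open>\<open>\<Gamma>\<close> is the quotient of the two saddle point blocks. In the first block column the
  contributions of \<open>X\<close> and of \<open>(1 / \<beta>) B\<^sup>T B\<close> add up to \<open>M\<close>, which cancels against \<open>M\<^sup>-\<^sup>1\<close>
  (\<open>collapse\<close>); in the second block column the factor \<open>-\<beta>\<close> undoes \<open>1 / \<beta>\<close> with opposite sign
  (\<open>cancel\<close>).\<close>

lemma Gamma_mat_mult_leading_block:
  fixes X K Mi B :: "real mat"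
  assumes X: "X \<in> carrier_mat n n" and K: "K \<in> carrier_mat n n" and B: "B \<in> carrier_mat m n"
    and Mi: "Mi \<in> carrier_mat n n" and \<beta>: "\<beta> \<noteq> 0"
    and Mi_inv: "Mi * (X + (1 / \<beta>) \<cdot>\<^sub>m (transpose_mat B * B)) = 1\<^sub>m n"
  shows "four_block_mat (1\<^sub>m n + K * Mi) ((1 / \<beta>) \<cdot>\<^sub>m (K * Mi * transpose_mat B))
           (B * Mi) ((1 / \<beta>) \<cdot>\<^sub>m (B * Mi * transpose_mat B))
         * four_block_mat X (transpose_mat B) B (- (\<beta> \<cdot>\<^sub>m 1\<^sub>m m))
       = four_block_mat (X + K) (transpose_mat B) B (0\<^sub>m m m)"
proof -
  have mI: "- (\<beta> \<cdot>\<^sub>m 1\<^sub>m m) = (- \<beta>) \<cdot>\<^sub>m (1\<^sub>m m :: real mat)" by auto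
  have collapse: "Y * Mi * X + (1 / \<beta>) \<cdot>\<^sub>m (Y * Mi * transpose_mat B) * B = Y"
    if Y: "Y \<in> carrier_mat r n" for Y r
  proof -
    have YM: "Y * Mi \<in> carrier_mat r n" using Y Mi by auto
    have "(1 / \<beta>) \<cdot>\<^sub>m (Y * Mi * transpose_mat B) * B = Y * Mi * ((1 / \<beta>) \<cdot>\<^sub>m (transpose_mat B * B))"
    proof -
      have "(1 / \<beta>) \<cdot>\<^sub>m (Y * Mi * transpose_mat B) * B = (1 / \<beta>) \<cdot>\<^sub>m (Y * Mi * transpose_mat B * B)"
        by (rule mult_smult_assoc_mat[of _ r m _ n]) (use YM B in auto)
      also have "Y * Mi * transpose_mat B * B = Y * Mi * (transpose_mat B * B)"
        by (rule assoc_mult_mat[OF YM]) (use B in auto)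
      also have "(1 / \<beta>) \<cdot>\<^sub>m \<dots> = Y * Mi * ((1 / \<beta>) \<cdot>\<^sub>m (transpose_mat B * B))"
        by (rule mult_smult_distrib[OF YM, symmetric]) (use B in auto)
      finally show ?thesis .
    qed
    then have "Y * Mi * X + (1 / \<beta>) \<cdot>\<^sub>m (Y * Mi * transpose_mat B) * B
        = Y * Mi * (X + (1 / \<beta>) \<cdot>\<^sub>m (transpose_mat B * B))"
      using mult_add_distrib_mat[OF YM X, of "(1 / \<beta>) \<cdot>\<^sub>m (transpose_mat B * B)"] B by simp
    also have "\<dots> = Y * (Mi * (X + (1 / \<beta>) \<cdot>\<^sub>m (transpose_mat B * B)))"
      by (rule assoc_mult_mat[OF Y Mi]) (use X B in auto)
    finally show ?thesis using Y Mi_inv by simp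
  qed
  have cancel: "Z * transpose_mat B + (1 / \<beta>) \<cdot>\<^sub>m (Z * transpose_mat B) * - (\<beta> \<cdot>\<^sub>m 1\<^sub>m m) = 0\<^sub>m r m"
    if Z: "Z \<in> carrier_mat r n" for Z r
  proof -
    have ZB: "Z * transpose_mat B \<in> carrier_mat r m" using Z B by auto
    have "(1 / \<beta>) \<cdot>\<^sub>m (Z * transpose_mat B) * - (\<beta> \<cdot>\<^sub>m 1\<^sub>m m) = (- \<beta>) \<cdot>\<^sub>m ((1 / \<beta>) \<cdot>\<^sub>m (Z * transpose_mat B))"
      unfolding mI using ZB by (subst mult_smult_distrib[of _ r m _ m]) auto
    also have "(- \<beta>) \<cdot>\<^sub>m ((1 / \<beta>) \<cdot>\<^sub>m (Z * transpose_mat B)) = - (Z * transpose_mat B)"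
      by (rule eq_matI) (use \<beta> in simp_all)
    finally have "(1 / \<beta>) \<cdot>\<^sub>m (Z * transpose_mat B) * - (\<beta> \<cdot>\<^sub>m 1\<^sub>m m) = - (Z * transpose_mat B)" .
    then show ?thesis by (simp only: add_uminus_mat[OF ZB])
  qed
  have KM: "K * Mi \<in> carrier_mat n n" and BM: "B * Mi \<in> carrier_mat m n" using K B Mi by auto
  have KMBt: "K * Mi * transpose_mat B \<in> carrier_mat n m" using KM B by auto
  have split: "(1\<^sub>m n + K * Mi) * Y + Z = Y + (K * Mi * Y + Z)"
    if Y: "Y \<in> carrier_mat n c" and Z: "Z \<in> carrier_mat n c" for Y Z c
  proof -
    have KMY: "K * Mi * Y \<in> carrier_mat n c" using KM Y by auto
    have "(1\<^sub>m n + K * Mi) * Y = Y + K * Mi * Y"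
      using add_mult_distrib_mat[OF one_carrier_mat KM Y] Y by simp
    then show ?thesis by (simp only: assoc_add_mat[OF Y KMY Z])
  qed
  have "four_block_mat (1\<^sub>m n + K * Mi) ((1 / \<beta>) \<cdot>\<^sub>m (K * Mi * transpose_mat B))
           (B * Mi) ((1 / \<beta>) \<cdot>\<^sub>m (B * Mi * transpose_mat B))
         * four_block_mat X (transpose_mat B) B (- (\<beta> \<cdot>\<^sub>m 1\<^sub>m m))
       = four_block_mat
          ((1\<^sub>m n + K * Mi) * X + (1 / \<beta>) \<cdot>\<^sub>m (K * Mi * transpose_mat B) * B)
          ((1\<^sub>m n + K * Mi) * transpose_mat B + (1 / \<beta>) \<cdot>\<^sub>m (K * Mi * transpose_mat B) * - (\<beta> \<cdot>\<^sub>m 1\<^sub>m m))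
          (B * Mi * X + (1 / \<beta>) \<cdot>\<^sub>m (B * Mi * transpose_mat B) * B)
          (B * Mi * transpose_mat B + (1 / \<beta>) \<cdot>\<^sub>m (B * Mi * transpose_mat B) * - (\<beta> \<cdot>\<^sub>m 1\<^sub>m m))"
    by (rule mult_four_block_mat[of _ n n _ m _ m _ _ n _ m]) (use X B KM BM in auto)
  also have "(1\<^sub>m n + K * Mi) * X + (1 / \<beta>) \<cdot>\<^sub>m (K * Mi * transpose_mat B) * B
      = X + (K * Mi * X + (1 / \<beta>) \<cdot>\<^sub>m (K * Mi * transpose_mat B) * B)"
    by (rule split[OF X mult_carrier_mat[OF smult_carrier_mat[OF KMBt] B]])
  also have "(1\<^sub>m n + K * Mi) * transpose_mat B + (1 / \<beta>) \<cdot>\<^sub>m (K * Mi * transpose_mat B) * - (\<beta> \<cdot>\<^sub>m 1\<^sub>m m)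
      = transpose_mat B + (K * Mi * transpose_mat B + (1 / \<beta>) \<cdot>\<^sub>m (K * Mi * transpose_mat B) * - (\<beta> \<cdot>\<^sub>m 1\<^sub>m m))"
    by (rule split[OF _ mult_carrier_mat[OF smult_carrier_mat[OF KMBt]]]) (use B in auto)
  finally show ?thesis
    using right_add_zero_mat[of "transpose_mat B" n m] B
    by (simp only: collapse[OF K] collapse[OF B] cancel[OF KM] cancel[OF BM] transpose_carrier_mat)
qed

section \<open>Eigenvalues with multiplicity\<close>

lemma complex_eigvals_remove_linear_power:
  assumes P: "P \<in> carrier_mat k k" and L: "L \<in> carrier_mat l l"
    and eq: "char_poly P = char_poly L * [:- 1, 1:] ^ p"
  shows "complex_eigvals P - replicate_mset p 1 = complex_eigvals L"
    and "p \<le> Polynomial.order 1 (char_poly (map_mat complex_of_real P))"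
    and "p > 0 \<Longrightarrow> eigenvalue (map_mat complex_of_real P) 1"
proof -
  interpret of_real_poly: map_poly_comm_ring_hom complex_of_real ..
  have cP: "map_mat complex_of_real P \<in> carrier_mat k k"
    and cL: "map_mat complex_of_real L \<in> carrier_mat l l" using P L by auto
  have lin: "map_poly complex_of_real [:- 1, 1:] = [:- 1, 1:]" by simp
  have fac: "char_poly (map_mat complex_of_real P)
      = char_poly (map_mat complex_of_real L) * [:- 1, 1:] ^ p"
    unfolding of_real_hom.char_poly_hom[OF P] of_real_hom.char_poly_hom[OF L] eq
    by (simp add: of_real_poly.hom_mult of_real_poly.hom_power lin)
  have nz: "char_poly (map_mat complex_of_real L) \<noteq> 0" "char_poly (map_mat complex_of_real P) \<noteq> 0"
    using degree_monic_char_poly[OF cL] degree_monic_char_poly[OF cP] by auto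
  have "complex_eigvals P = complex_eigvals L + replicate_mset p 1"
    unfolding complex_eigvals_def fac using nz(1)
    by (subst proots_mult) (auto simp: proots_power)
  then show "complex_eigvals P - replicate_mset p 1 = complex_eigvals L" by simp
  show "p \<le> Polynomial.order 1 (char_poly (map_mat complex_of_real P))"
    using fac nz(2) order_divides[of 1 p] by (metis dvd_triv_right)
  show "eigenvalue (map_mat complex_of_real P) 1" if "p > 0"
    unfolding eigenvalue_root_char_poly[OF cP] fac using that by simp
qed

theorem theorem2:
  fixes n m p :: nat and \<alpha> \<beta> :: real and A B C D :: "real mat"
  assumes A: "spd_mat n A"
    and D: "spd_mat p D"
    and B: "B \<in> carrier_mat m n" and B_full_row_rank: "rank_mat m B = m"
    and C: "C \<in> carrier_mat p n" and C_rank_deficient: "rank_mat p C < min p n"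
    and \<alpha>: "\<alpha> > 0" and \<beta>: "\<beta> > 0"
  shows "let Q = Q_mat n m p \<alpha> \<beta> A B C D;
             P = inv_mat Q * tildeA_mat n m p A B C D
         in invertible_mat Q
          \<and> eigenvalue (map_mat complex_of_real P) 1
          \<and> p \<le> Polynomial.order 1 (char_poly (map_mat complex_of_real P))
          \<and> complex_eigvals P - replicate_mset p 1 = complex_eigvals (Gamma_mat n \<alpha> \<beta> A B C D)"
proof -
  have Ac: "A \<in> carrier_mat n n" and Dc: "D \<in> carrier_mat p p"
    using A D by (auto simp: spd_mat_def)
  have detD: "det D \<noteq> 0" by (rule spd_mat_det[OF D])
  note Di = inv_mat_inverse[OF Dc detD]
  define X where "X = A + \<alpha> \<cdot>\<^sub>m (transpose_mat B * B)"
  define CDC where "CDC = transpose_mat C * inv_mat D * C"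
  define K where "K = CDC - \<alpha> \<cdot>\<^sub>m (transpose_mat B * B)"
  define Q1 where "Q1 = four_block_mat X (transpose_mat B) B (- (\<beta> \<cdot>\<^sub>m 1\<^sub>m m))"
  define S where "S = four_block_mat A (transpose_mat B) B (0\<^sub>m m m)"
  define G where "G = append_rows (transpose_mat C) (0\<^sub>m m p)"
  define H where "H = append_cols_mat C (0\<^sub>m p m)"
  define \<Gamma> where "\<Gamma> = Gamma_mat n \<alpha> \<beta> A B C D"
  have Xc: "X \<in> carrier_mat n n" and CDCc: "CDC \<in> carrier_mat n n" and Kc: "K \<in> carrier_mat n n"
    using Ac B C Di by (auto simp: X_def CDC_def K_def)

  have M: "M_mat \<alpha> \<beta> A B = X + (1 / \<beta>) \<cdot>\<^sub>m (transpose_mat B * B)"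
    unfolding M_mat_def X_def by (rule eq_matI) (use Ac B in \<open>auto simp: algebra_simps\<close>)
  have Mc: "M_mat \<alpha> \<beta> A B \<in> carrier_mat n n" using Ac B by (auto simp: M_mat_def)
  have detM: "det (M_mat \<alpha> \<beta> A B) \<noteq> 0"
    unfolding M_mat_def by (rule spd_mat_det[OF spd_mat_add_gram[OF A B]]) (use \<alpha> \<beta> in auto)
  note Mi = inv_mat_inverse[OF Mc detM]

  have Q1c: "Q1 \<in> carrier_mat (n + m) (n + m)" and Sc: "S \<in> carrier_mat (n + m) (n + m)"
    using Xc Ac by (auto simp: Q1_def S_def)
  have Gc: "G \<in> carrier_mat (n + m) p" using C by (auto simp: G_def)
  have Hc: "H \<in> carrier_mat p (n + m)" using C by (auto simp: H_def append_cols_mat_def)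
  have \<Gamma>_eq: "\<Gamma> = four_block_mat (1\<^sub>m n + K * inv_mat (M_mat \<alpha> \<beta> A B))
      ((1 / \<beta>) \<cdot>\<^sub>m (K * inv_mat (M_mat \<alpha> \<beta> A B) * transpose_mat B))
      (B * inv_mat (M_mat \<alpha> \<beta> A B))
      ((1 / \<beta>) \<cdot>\<^sub>m (B * inv_mat (M_mat \<alpha> \<beta> A B) * transpose_mat B))"
    unfolding \<Gamma>_def Gamma_mat_def Let_def K_def CDC_def ..
  have \<Gamma>c: "\<Gamma> \<in> carrier_mat (n + m) (n + m)"
    unfolding \<Gamma>_eq using Kc Mi B by auto
  have detQ1: "det Q1 \<noteq> 0"
    unfolding Q1_def by (rule saddle_block_det[OF Xc B]) (use \<beta> detM M in auto)

  have "\<Gamma> * Q1 = four_block_mat (X + K) (transpose_mat B) B (0\<^sub>m m m)"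
    unfolding \<Gamma>_eq Q1_def
    by (rule Gamma_mat_mult_leading_block[OF Xc Kc B Mi(1)]) (use \<beta> Mi M in auto)
  also have "X + K = A + CDC"
    by (rule eq_matI) (use Ac B CDCc in \<open>auto simp: X_def K_def\<close>)
  finally have \<Gamma>Q1: "\<Gamma> * Q1 = four_block_mat (A + CDC) (transpose_mat B) B (0\<^sub>m m m)" .
  (* All factors are padded with empty blocks, so that the four-block product rule applies. *)
  have "G * inv_mat D = four_block_mat (transpose_mat C * inv_mat D) (0\<^sub>m n 0) (0\<^sub>m m p) (0\<^sub>m m 0)"
  proof -
    have "inv_mat D = four_block_mat (inv_mat D) (0\<^sub>m p 0) (0\<^sub>m 0 p) (0\<^sub>m 0 0)"
      by (rule eq_matI) (use Di in auto)
    then have "G * inv_mat D = four_block_mat (transpose_mat C) (0\<^sub>m n 0) (0\<^sub>m m p) (0\<^sub>m m 0)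
        * four_block_mat (inv_mat D) (0\<^sub>m p 0) (0\<^sub>m 0 p) (0\<^sub>m 0 0)"
      using C by (simp add: G_def append_rows_def)
    also have "\<dots> = four_block_mat (transpose_mat C * inv_mat D + 0\<^sub>m n 0 * 0\<^sub>m 0 p)
        (transpose_mat C * 0\<^sub>m p 0 + 0\<^sub>m n 0 * 0\<^sub>m 0 0)
        (0\<^sub>m m p * inv_mat D + 0\<^sub>m m 0 * 0\<^sub>m 0 p) (0\<^sub>m m p * 0\<^sub>m p 0 + 0\<^sub>m m 0 * 0\<^sub>m 0 0)"
      by (rule mult_four_block_mat) (use C Di in auto)
    finally show ?thesis using C Di by simp
  qed
  then have "G * inv_mat D * H = four_block_mat (transpose_mat C * inv_mat D) (0\<^sub>m n 0) (0\<^sub>m m p) (0\<^sub>m m 0)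
      * four_block_mat C (0\<^sub>m p m) (0\<^sub>m 0 n) (0\<^sub>m 0 m)"
    using C by (simp add: H_def append_cols_mat_def)
  also have "\<dots> = four_block_mat (transpose_mat C * inv_mat D * C + 0\<^sub>m n 0 * 0\<^sub>m 0 n)
      (transpose_mat C * inv_mat D * 0\<^sub>m p m + 0\<^sub>m n 0 * 0\<^sub>m 0 m)
      (0\<^sub>m m p * C + 0\<^sub>m m 0 * 0\<^sub>m 0 n) (0\<^sub>m m p * 0\<^sub>m p m + 0\<^sub>m m 0 * 0\<^sub>m 0 m)"
    by (rule mult_four_block_mat) (use C Di in auto)
  finally have GDH: "G * inv_mat D * H = four_block_mat CDC (0\<^sub>m n m) (0\<^sub>m m n) (0\<^sub>m m m)"
    using C Di by (simp add: CDC_def)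
  have L_eq: "\<Gamma> * Q1 = S + G * inv_mat D * H"
    unfolding \<Gamma>Q1 GDH S_def
    by (subst add_four_block_mat[of _ n n _ m _ m]) (use Ac B CDCc in auto)

  have Q: "Q_mat n m p \<alpha> \<beta> A B C D = four_block_mat Q1 (0\<^sub>m (n + m) p) H (- D)"
  proof -
    have "append_rows (0\<^sub>m n p) (0\<^sub>m m p :: real mat) = 0\<^sub>m (n + m) p"
      by (rule eq_matI) (auto simp: append_rows_def)
    then show ?thesis by (simp add: Q_mat_def nine_block_mat_def Q1_def X_def H_def)
  qed
  have T: "tildeA_mat n m p A B C D = four_block_mat S G H (- D)"
    by (simp add: tildeA_mat_def nine_block_mat_def S_def G_def H_def)
  note block = block_preconditioned_char_poly[OF Q1c Sc Gc Hc Dc \<Gamma>c detQ1 detD L_eq, folded Q T]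
  have Qc: "Q_mat n m p \<alpha> \<beta> A B C D \<in> carrier_mat (n + m + p) (n + m + p)"
    using Q1c Dc by (auto simp: Q)
  have Tc: "tildeA_mat n m p A B C D \<in> carrier_mat (n + m + p) (n + m + p)"
    using Sc Dc by (auto simp: T)
  have Pc: "inv_mat (Q_mat n m p \<alpha> \<beta> A B C D) * tildeA_mat n m p A B C D
      \<in> carrier_mat (n + m + p) (n + m + p)"
    using inv_mat_inverse(1)[OF Qc block(1)] Tc by auto
  have p: "p > 0" using C_rank_deficient by simp
  show ?thesis
    unfolding Let_def \<Gamma>_def[symmetric]
    using invertible_mat_if_det[OF Qc block(1)]
      complex_eigvals_remove_linear_power[OF Pc \<Gamma>c block(2)] p by blast
qed

end
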